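(* Let $G$ be a topological group. If $p\colon E\to B$ and $p'\colon E'\to B$ are $G$-fibrations which are fibrewise $G$-homotopy equivalent, then $$\mathrm{TC}^{G}[p\colon E\to B]=\mathrm{TC}^{G}[p'\colon E'\to B].$$
   Context: All spaces are Hausdorff, $I=[0,1]$, path spaces carry the compact-open topology. A $G$-map is a continuous equivariant map; a $G$-homotopy is an equivariant homotopy ($G$ acting trivially on $I$). A $G$-fibration is a $G$-map with the $G$-homotopy lifting property with respect to every $G$-space. $G$-fibrations $p\colon E\to B$ and $p'\colon E'\to B$ are fibrewise $G$-homotopy equivalent if there are $G$-maps $f\colon E\to E'$ and $f'\colon E'\to E$ with $p'\circ f=p$, $p\circ f'=p'$, such that $f'\circ f$ and $f\circ f'$ are homotopic to the respective identity maps through $G$-homotopies which at each time commute with the projections to $B$. Equivariant sectional category: for a $G$-map $q\colon X\to Y$, $\mathrm{secat}_G(q)$ is the least positive integer $k$ such that $Y$ has a cover by $G$-invariant open sets $U_1,\dots,U_k$ with $G$-maps $s_i\colon U_i\to X$ such that $q\circ s_i$ is $G$-homotopic to the inclusion $U_i\hookrightarrow Y$ ($\infty$ if there is no such $k$). Invariant parametrized topological complexity: for a $G$-fibration $p\colon E\to B$, let $E^I_B$ be the space of paths $\gamma\colon I\to E$ whose image lies in a single fibre of $p$, with $(g\cdot\gamma)(t)=g\cdot\gamma(t)$. Put $E^I_B\times_{E/G}E^I_B=\{(\gamma,\delta)\in E^I_B\times E^I_B : G\cdot\gamma(1)=G\cdot\delta(0)\}$ and $E\times_{B/G}E=\{(e_1,e_2)\in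 E\times E : G\cdot p(e_1)=G\cdot p(e_2)\}$, with the componentwise $(G\times G)$-actions, and let $\Psi(\gamma,\delta)=(\gamma(0),\delta(1))$, a $(G\times G)$-fibration $E^I_B\times_{E/G}E^I_B\to E\times_{B/G}E$. Then $\mathrm{TC}^G[p\colon E\to B]:=\mathrm{secat}_{G\times G}(\Psi)$. *)

theory Defs
  imports "HOL-Analysis.Analysis" "HOL-Algebra.Group_Action" "HOL-Library.Extended_Nat"
begin

section \<open>Topological groups and G-spaces\<close>

definition topological_group :: "('g, 'm) monoid_scheme \<Rightarrow> 'g topology \<Rightarrow> bool"
  where "topological_group G T \<longleftrightarrow>
    group G \<and> topspace T = carrier G \<and> Hausdorff_space T \<and>
    continuous_map (prod_topology T T) T (\<lambda>(g, h). g \<otimes>\<^bsub>G\<^esub> h) \<and>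
    continuous_map T T (\<lambda>g. inv\<^bsub>G\<^esub> g)"

text \<open>
  The library's \<^const>\<open>group_action\<close> requires every group element to act by a function that is
  extensional on the space. The restriction below removes this constraint, so that only the values
  of the action on the points of the space matter.
\<close>

definition G_space ::
    "('g, 'm) monoid_scheme \<Rightarrow> 'g topology \<Rightarrow> 'x topology \<Rightarrow> ('g \<Rightarrow> 'x \<Rightarrow> 'x) \<Rightarrow> bool"
  where "G_space G T X a \<longleftrightarrow>
    Hausdorff_space X \<and>
    group_action G (topspace X) (\<lambda>g. restrict (a g) (topspace X)) \<and>
    continuous_map (prod_topology T X) X (\<lambda>(g, x). a g x)"

definition equivariant ::
    "('g, 'm) monoid_scheme \<Rightarrow> 'x topology \<Rightarrow> ('g \<Rightarrow> 'x \<Rightarrow> 'x) \<Rightarrow> ('g \<Rightarrow> 'y \<Rightarrow> 'y) \<Rightarrow> ('x \<Rightarrow> 'y) \<Rightarrow> bool"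
  where "equivariant G X a b f \<longleftrightarrow> (\<forall>g\<in>carrier G. \<forall>x\<in>topspace X. f (a g x) = b g (f x))"

definition G_map ::
    "('g, 'm) monoid_scheme \<Rightarrow> 'x topology \<Rightarrow> ('g \<Rightarrow> 'x \<Rightarrow> 'x) \<Rightarrow> 'y topology \<Rightarrow> ('g \<Rightarrow> 'y \<Rightarrow> 'y)
      \<Rightarrow> ('x \<Rightarrow> 'y) \<Rightarrow> bool"
  where "G_map G X a Y b f \<longleftrightarrow> continuous_map X Y f \<and> equivariant G X a b f"

text \<open>
  A homotopy on the product of the interval with X is equivariant, for the trivial action on the
  interval, iff each of its time slices is; so this is the relation of equivariant homotopy.
\<close>

definition G_homotopic ::
    "('g, 'm) monoid_scheme \<Rightarrow> 'x topology \<Rightarrow> ('g \<Rightarrow> 'x \<Rightarrow> 'x) \<Rightarrow> 'y topology \<Rightarrow> ('g \<Rightarrow> 'y \<Rightarrow> 'y)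
      \<Rightarrow> ('x \<Rightarrow> 'y) \<Rightarrow> ('x \<Rightarrow> 'y) \<Rightarrow> bool"
  where "G_homotopic G X a Y b = homotopic_with (equivariant G X a b) X Y"


section \<open>G-fibrations\<close>

abbreviation unit_interval :: "real topology"
  where "unit_interval \<equiv> top_of_set {0..1}"

definition cylinder_action :: "('g \<Rightarrow> 'x \<Rightarrow> 'x) \<Rightarrow> 'g \<Rightarrow> real \<times> 'x \<Rightarrow> real \<times> 'x"
  where "cylinder_action a g = (\<lambda>(t, x). (t, a g x))"

definition G_homotopy_lifting ::
    "('g, 'm) monoid_scheme \<Rightarrow> 'x topology \<Rightarrow> ('g \<Rightarrow> 'x \<Rightarrow> 'x) \<Rightarrow> 'e topology \<Rightarrow> ('g \<Rightarrow> 'e \<Rightarrow> 'e)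
      \<Rightarrow> 'b topology \<Rightarrow> ('g \<Rightarrow> 'b \<Rightarrow> 'b) \<Rightarrow> ('e \<Rightarrow> 'b) \<Rightarrow> bool"
  where "G_homotopy_lifting G X c E a B b p \<longleftrightarrow>
    (\<forall>f H. G_map G X c E a f \<and>
           G_map G (prod_topology unit_interval X) (cylinder_action c) B b H \<and>
           (\<forall>x\<in>topspace X. H (0, x) = p (f x)) \<longrightarrow>
      (\<exists>K. G_map G (prod_topology unit_interval X) (cylinder_action c) E a K \<and>
           (\<forall>x\<in>topspace X. K (0, x) = f x) \<and>
           (\<forall>t\<in>{0..1}. \<forall>x\<in>topspace X. p (K (t, x)) = H (t, x))))"

text \<open>
  HOL cannot quantify over types inside a formula, so the test spaces range over all G-spaces with
  points in one fixed type, chosen large enough to contain the mapping path space of p. This is no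
  restriction: theorem \<open>G_fibration_lifting\<close> below derives the lifting property for G-spaces over
  an arbitrary type.
\<close>

definition G_fibration ::
    "('g, 'm) monoid_scheme \<Rightarrow> 'g topology \<Rightarrow> 'e topology \<Rightarrow> ('g \<Rightarrow> 'e \<Rightarrow> 'e)
      \<Rightarrow> 'b topology \<Rightarrow> ('g \<Rightarrow> 'b \<Rightarrow> 'b) \<Rightarrow> ('e \<Rightarrow> 'b) \<Rightarrow> bool"
  where "G_fibration G T E a B b p \<longleftrightarrow>
    G_space G T E a \<and> G_space G T B b \<and> G_map G E a B b p \<and>
    (\<forall>(X :: ('e \<times> (real \<Rightarrow> 'b)) topology) c.
        G_space G T X c \<longrightarrow> G_homotopy_lifting G X c E a B b p)"

definition fibrewise_G_homotopy_equivalent ::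
    "('g, 'm) monoid_scheme \<Rightarrow> 'e topology \<Rightarrow> ('g \<Rightarrow> 'e \<Rightarrow> 'e) \<Rightarrow> ('e \<Rightarrow> 'b)
      \<Rightarrow> 'f topology \<Rightarrow> ('g \<Rightarrow> 'f \<Rightarrow> 'f) \<Rightarrow> ('f \<Rightarrow> 'b) \<Rightarrow> bool"
  where "fibrewise_G_homotopy_equivalent G E a p E' a' p' \<longleftrightarrow>
    (\<exists>f f'. G_map G E a E' a' f \<and> G_map G E' a' E a f' \<and>
       (\<forall>x\<in>topspace E. p' (f x) = p x) \<and> (\<forall>y\<in>topspace E'. p (f' y) = p' y) \<and>
       homotopic_with (\<lambda>h. equivariant G E a a h \<and> (\<forall>x\<in>topspace E. p (h x) = p x))
         E E (f' \<circ> f) id \<and>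
       homotopic_with (\<lambda>h. equivariant G E' a' a' h \<and> (\<forall>y\<in>topspace E'. p' (h y) = p' y))
         E' E' (f \<circ> f') id)"


section \<open>Equivariant sectional category\<close>

text \<open>The infimum of the empty set in \<^typ>\<open>enat\<close> is infinity.\<close>

definition secat ::
    "('g, 'm) monoid_scheme \<Rightarrow> 'x topology \<Rightarrow> ('g \<Rightarrow> 'x \<Rightarrow> 'x) \<Rightarrow> 'y topology \<Rightarrow> ('g \<Rightarrow> 'y \<Rightarrow> 'y)
      \<Rightarrow> ('x \<Rightarrow> 'y) \<Rightarrow> enat"
  where "secat G X a Y b q = Inf {enat k | k. k \<ge> 1 \<and>
    (\<exists>U s. (\<Union>i\<in>{1..k}. U i) = topspace Y \<and>
       (\<forall>i\<in>{1..k}.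
          openin Y (U i) \<and> (\<forall>g\<in>carrier G. b g ` U i \<subseteq> U i) \<and>
          G_map G (subtopology Y (U i)) b X a (s i) \<and>
          G_homotopic G (subtopology Y (U i)) b Y b (q \<circ> s i) id))}"


section \<open>Invariant parametrized topological complexity\<close>

text \<open>Continuous maps from X to Y are represented by functions extensional on X.\<close>

definition compact_open_topology :: "'x topology \<Rightarrow> 'y topology \<Rightarrow> ('x \<Rightarrow> 'y) topology"
  where "compact_open_topology X Y = topology_generated_by
    {{f \<in> extensional (topspace X). continuous_map X Y f \<and> f ` K \<subseteq> V} | K V.
       compactin X K \<and> openin Y V}"

definition path_action :: "('g \<Rightarrow> 'e \<Rightarrow> 'e) \<Rightarrow> 'g \<Rightarrow> (real \<Rightarrow> 'e) \<Rightarrow> real \<Rightarrow> 'e"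
  where "path_action a g \<gamma> = (\<lambda>t\<in>{0..1}. a g (\<gamma> t))"

definition fibre_paths :: "'e topology \<Rightarrow> 'b topology \<Rightarrow> ('e \<Rightarrow> 'b) \<Rightarrow> (real \<Rightarrow> 'e) topology"
  where "fibre_paths E B p = subtopology (compact_open_topology unit_interval E)
    {\<gamma>. \<exists>z\<in>topspace B. \<forall>t\<in>{0..1}. p (\<gamma> t) = z}"

definition fibre_path_pairs ::
    "('g, 'm) monoid_scheme \<Rightarrow> 'e topology \<Rightarrow> ('g \<Rightarrow> 'e \<Rightarrow> 'e) \<Rightarrow> 'b topology \<Rightarrow> ('e \<Rightarrow> 'b)
      \<Rightarrow> ((real \<Rightarrow> 'e) \<times> (real \<Rightarrow> 'e)) topology"
  where "fibre_path_pairs G E a B p =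
    subtopology (prod_topology (fibre_paths E B p) (fibre_paths E B p))
      {(\<gamma>, \<delta>). orbit G a (\<gamma> 1) = orbit G a (\<delta> 0)}"

definition orbit_fibre_product ::
    "('g, 'm) monoid_scheme \<Rightarrow> 'e topology \<Rightarrow> ('g \<Rightarrow> 'b \<Rightarrow> 'b) \<Rightarrow> ('e \<Rightarrow> 'b) \<Rightarrow> ('e \<times> 'e) topology"
  where "orbit_fibre_product G E b p =
    subtopology (prod_topology E E) {(e1, e2). orbit G b (p e1) = orbit G b (p e2)}"

definition prod_action :: "('g \<Rightarrow> 'x \<Rightarrow> 'x) \<Rightarrow> 'g \<times> 'g \<Rightarrow> 'x \<times> 'x \<Rightarrow> 'x \<times> 'x"
  where "prod_action a = (\<lambda>(g, h) (x, y). (a g x, a h y))"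

definition outer_endpoints :: "(real \<Rightarrow> 'e) \<times> (real \<Rightarrow> 'e) \<Rightarrow> 'e \<times> 'e"
  where "outer_endpoints = (\<lambda>(\<gamma>, \<delta>). (\<gamma> 0, \<delta> 1))"

definition invariant_param_TC ::
    "('g, 'm) monoid_scheme \<Rightarrow> 'e topology \<Rightarrow> ('g \<Rightarrow> 'e \<Rightarrow> 'e)
      \<Rightarrow> 'b topology \<Rightarrow> ('g \<Rightarrow> 'b \<Rightarrow> 'b) \<Rightarrow> ('e \<Rightarrow> 'b) \<Rightarrow> enat"
  where "invariant_param_TC G E a B b p =
    secat (G \<times>\<times> G)
      (fibre_path_pairs G E a B p) (prod_action (path_action a))
      (orbit_fibre_product G E b p) (prod_action a)
      outer_endpoints"


section \<open>The lifting property with respect to all G-spaces\<close>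

lemma G_spaceD:
  assumes "G_space G T X a"
  shows "Hausdorff_space X"
    and "continuous_map (prod_topology T X) X (\<lambda>(g, x). a g x)"
    and "\<And>g x. g \<in> carrier G \<Longrightarrow> x \<in> topspace X \<Longrightarrow> a g x \<in> topspace X"
    and "\<And>x. x \<in> topspace X \<Longrightarrow> a \<one>\<^bsub>G\<^esub> x = x"
    and "\<And>g h x. g \<in> carrier G \<Longrightarrow> h \<in> carrier G \<Longrightarrow> x \<in> topspace X \<Longrightarrow>
           a (g \<otimes>\<^bsub>G\<^esub> h) x = a g (a h x)"
proof -
  have ga: "group_action G (topspace X) (\<lambda>g. restrict (a g) (topspace X))"
    using assms by (simp add: G_space_def)
  show "Hausdorff_space X" "continuous_map (prod_topology T X) X (\<lambda>(g, x). a g x)"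
    using assms by (simp_all add: G_space_def)
  show cl: "a g x \<in> topspace X" if "g \<in> carrier G" "x \<in> topspace X" for g x
    using group_action.element_image[OF ga that refl] that by simp
  show "a \<one>\<^bsub>G\<^esub> x = x" if "x \<in> topspace X" for x
    using fun_cong[OF group_action.id_eq_one[OF ga], of x] that by simp
  show "a (g \<otimes>\<^bsub>G\<^esub> h) x = a g (a h x)"
    if "g \<in> carrier G" "h \<in> carrier G" "x \<in> topspace X" for g h x
    using group_action.composition_rule[OF ga that(3,1,2)] that cl[OF that(2,3)] by simp
qed

lemma G_spaceI:
  assumes G: "group G" and T: "topspace T = carrier G"
    and H: "Hausdorff_space X"
    and C: "continuous_map (prod_topology T X) X (\<lambda>(g, x). a g x)"
    and one: "\<And>x. x \<in> topspace X \<Longrightarrow> a \<one>\<^bsub>G\<^esub> x = x"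
    and mult: "\<And>g h x. g \<in> carrier G \<Longrightarrow> h \<in> carrier G \<Longrightarrow> x \<in> topspace X \<Longrightarrow>
           a (g \<otimes>\<^bsub>G\<^esub> h) x = a g (a h x)"
  shows "G_space G T X a"
proof -
  interpret group G by (rule G)
  have cl: "a g x \<in> topspace X" if "g \<in> carrier G" "x \<in> topspace X" for g x
    using continuous_map_image_subset_topspace[OF C] that T by force
  have inv1: "a (inv\<^bsub>G\<^esub> g) (a g x) = x" if "g \<in> carrier G" "x \<in> topspace X" for g x
    using mult[of "inv\<^bsub>G\<^esub> g" g x] that one by (simp add: l_inv)
  have inv2: "a g (a (inv\<^bsub>G\<^esub> g) x) = x" if "g \<in> carrier G" "x \<in> topspace X" for g x
    using mult[of g "inv\<^bsub>G\<^esub> g" x] that one by (simp add: r_inv)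
  have bij: "restrict (a g) (topspace X) \<in> Bij (topspace X)" if g: "g \<in> carrier G" for g
  proof -
    have "bij_betw (a g) (topspace X) (topspace X)"
      by (rule bij_betw_byWitness[where f' = "a (inv\<^bsub>G\<^esub> g)"])
         (use g cl inv1 inv2 in auto)
    then show ?thesis by (simp add: Bij_def bij_betw_restrict_eq)
  qed
  have "group_hom G (BijGroup (topspace X)) (\<lambda>g. restrict (a g) (topspace X))"
    unfolding group_hom_def group_hom_axioms_def
  proof (intro conjI G group_BijGroup homI)
    fix g h assume gh: "g \<in> carrier G" "h \<in> carrier G"
    show "restrict (a (g \<otimes>\<^bsub>G\<^esub> h)) (topspace X) =
      restrict (a g) (topspace X) \<otimes>\<^bsub>BijGroup (topspace X)\<^esub> restrict (a h) (topspace X)"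
      using gh bij by (auto simp: BijGroup_def compose_def mult cl fun_eq_iff restrict_def)
  qed (use bij in \<open>simp add: BijGroup_def\<close>)
  then show ?thesis
    using H C by (simp add: G_space_def group_action_def)
qed

lemma topspace_compact_open:
  "topspace (compact_open_topology X Y) = {f \<in> extensional (topspace X). continuous_map X Y f}"
    (is "_ = ?C")
proof -
  have "?C = {f \<in> extensional (topspace X). continuous_map X Y f \<and> f ` {} \<subseteq> {}}" by simp
  then have "?C \<in> {{f \<in> extensional (topspace X). continuous_map X Y f \<and> f ` K \<subseteq> V} | K V.
       compactin X K \<and> openin Y V}"
    using compactin_empty openin_empty by blast
  then show ?thesis
    unfolding compact_open_topology_def topology_generated_by_topspace by blast
qed

lemma openin_compact_open:
  assumes "compactin X K" "openin Y V"
  shows "openin (compact_open_topology X Y)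
    {f \<in> extensional (topspace X). continuous_map X Y f \<and> f ` K \<subseteq> V}"
  unfolding compact_open_topology_def
  by (rule topology_generated_by_Basis) (use assms in blast)

lemma continuous_map_curry:
  assumes h: "continuous_map (prod_topology Z X) Y h"
  shows "continuous_map Z (compact_open_topology X Y) (\<lambda>z. \<lambda>t\<in>topspace X. h (z, t))"
proof -
  have sl: "continuous_map X Y (\<lambda>t\<in>topspace X. h (z, t))" if z: "z \<in> topspace Z" for z
  proof -
    have "continuous_map X (prod_topology Z X) (\<lambda>t. (z, t))"
      using z by (intro continuous_map_pairedI) auto
    from continuous_map_compose[OF this h] have "continuous_map X Y (\<lambda>t. h (z, t))"
      by (simp add: o_def)
    then show ?thesis by (rule continuous_map_eq) auto
  qed
  show ?thesis
    unfolding compact_open_topology_def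
  proof (rule continuous_on_generated_topo)
    fix S assume "S \<in> {{f \<in> extensional (topspace X). continuous_map X Y f \<and> f ` K \<subseteq> V} | K V.
       compactin X K \<and> openin Y V}"
    then obtain K V where S: "S = {f \<in> extensional (topspace X). continuous_map X Y f \<and> f ` K \<subseteq> V}"
      and K: "compactin X K" and V: "openin Y V" by blast
    have KX: "K \<subseteq> topspace X" using K by (rule compactin_subset_topspace)
    have hK: "continuous_map (prod_topology Z (subtopology X K)) Y h"
      using continuous_map_from_subtopology[OF h, of "topspace Z \<times> K"]
      by (metis prod_topology_subtopology(2) subtopology_Times subtopology_topspace)
    have "closedin (prod_topology Z (subtopology X K))
       {w \<in> topspace (prod_topology Z (subtopology X K)). h w \<in> topspace Y - V}"
      using hK V by (intro closedin_continuous_map_preimage) auto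
    moreover have "closed_map (prod_topology Z (subtopology X K)) Z fst"
      using K by (intro closed_map_fst) (simp add: compact_space_subtopology)
    ultimately have "closedin Z (fst `
       {w \<in> topspace (prod_topology Z (subtopology X K)). h w \<in> topspace Y - V})"
      (is "closedin Z ?D") by (simp add: closed_map_def)
    then have "openin Z (topspace Z - ?D)" by blast
    moreover have "h (z, t) \<in> topspace Y" if "z \<in> topspace Z" "t \<in> K" for z t
      using continuous_map_image_subset_topspace[OF h] that KX by force
    then have "(\<lambda>z. \<lambda>t\<in>topspace X. h (z, t)) -` S \<inter> topspace Z = topspace Z - ?D"
      using KX sl unfolding S apply (auto simp: image_iff subset_iff)
      using continuous_map_image_subset_topspace[OF h] by (metis (no_types, lifting))
    ultimately show "openin Z ((\<lambda>z. \<lambda>t\<in>topspace X. h (z, t)) -` S \<inter> topspace Z)" by simp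
  next
    show "(\<lambda>z. \<lambda>t\<in>topspace X. h (z, t)) ` topspace Z \<subseteq>
       \<Union>{{f \<in> extensional (topspace X). continuous_map X Y f \<and> f ` K \<subseteq> V} | K V.
         compactin X K \<and> openin Y V}"
      using topspace_compact_open[of X Y] sl
      unfolding compact_open_topology_def topology_generated_by_topspace by auto
  qed
qed

lemma continuous_map_eval:
  assumes X: "neighbourhood_base_of (compactin X) X"
  shows "continuous_map (prod_topology (compact_open_topology X Y) X) Y (\<lambda>(f, t). f t)"
  unfolding continuous_map
proof (intro conjI allI impI)
  show "(\<lambda>(f, t). f t) ` topspace (prod_topology (compact_open_topology X Y) X) \<subseteq> topspace Y"
    by (auto simp: topspace_compact_open continuous_map_def)
next
  fix V assume V: "openin Y V"
  show "openin (prod_topology (compact_open_topology X Y) X)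
    {w \<in> topspace (prod_topology (compact_open_topology X Y) X). (\<lambda>(f, t). f t) w \<in> V}"
    unfolding openin_prod_topology_alt
  proof (intro allI impI)
    fix f t
    assume "(f, t) \<in> {w \<in> topspace (prod_topology (compact_open_topology X Y) X).
      (\<lambda>(f, t). f t) w \<in> V}"
    then have f: "f \<in> extensional (topspace X)" "continuous_map X Y f"
      and t: "t \<in> topspace X" "f t \<in> V"
      by (auto simp: topspace_compact_open)
    have "openin X {s \<in> topspace X. f s \<in> V}"
      using f(2) V by (rule openin_continuous_map_preimage)
    then obtain U K where U: "openin X U" "compactin X K" "t \<in> U" "U \<subseteq> K"
        "K \<subseteq> {s \<in> topspace X. f s \<in> V}"
      using X t unfolding neighbourhood_base_of by (metis (no_types, lifting) mem_Collect_eq)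
    define W where "W = {f \<in> extensional (topspace X). continuous_map X Y f \<and> f ` K \<subseteq> V}"
    have "openin (compact_open_topology X Y) W"
      unfolding W_def using U(2) V by (rule openin_compact_open)
    moreover have "f \<in> W" using f U unfolding W_def by auto
    moreover have "W \<times> U \<subseteq> {w \<in> topspace (prod_topology (compact_open_topology X Y) X).
        (\<lambda>(f, t). f t) w \<in> V}"
      using U openin_subset[OF U(1)] unfolding W_def
      by (auto simp: topspace_compact_open image_subset_iff)
    ultimately show "\<exists>W U. openin (compact_open_topology X Y) W \<and> openin X U \<and> f \<in> W \<and> t \<in> U \<and>
       W \<times> U \<subseteq> {w \<in> topspace (prod_topology (compact_open_topology X Y) X).
         (\<lambda>(f, t). f t) w \<in> V}"
      using U(1,3) by blast
  qed
qed

lemma Hausdorff_compact_open: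
  assumes "Hausdorff_space Y"
  shows "Hausdorff_space (compact_open_topology X Y)"
  unfolding Hausdorff_space_def
proof (intro allI impI)
  fix f g
  assume "f \<in> topspace (compact_open_topology X Y) \<and>
          g \<in> topspace (compact_open_topology X Y) \<and> f \<noteq> g"
  then have f: "f \<in> extensional (topspace X)" "continuous_map X Y f"
    and g: "g \<in> extensional (topspace X)" "continuous_map X Y g" and "f \<noteq> g"
    by (auto simp: topspace_compact_open)
  then obtain t where t: "t \<in> topspace X" "f t \<noteq> g t"
    by (meson extensionalityI)
  moreover have "f t \<in> topspace Y" "g t \<in> topspace Y"
    using f g t continuous_map_image_subset_topspace by blast+
  ultimately obtain V W where VW: "openin Y V" "openin Y W" "f t \<in> V" "g t \<in> W" "disjnt V W"
    using assms unfolding Hausdorff_space_def by meson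
  define N where "N V = {f \<in> extensional (topspace X). continuous_map X Y f \<and> f ` {t} \<subseteq> V}" for V
  have "openin (compact_open_topology X Y) (N V)" "openin (compact_open_topology X Y) (N W)"
    unfolding N_def using t VW by (intro openin_compact_open; simp)+
  moreover have "f \<in> N V" "g \<in> N W" "disjnt (N V) (N W)"
    using f g VW unfolding N_def disjnt_def by auto
  ultimately show "\<exists>U V. openin (compact_open_topology X Y) U \<and>
      openin (compact_open_topology X Y) V \<and> f \<in> U \<and> g \<in> V \<and> disjnt U V"
    by blast
qed

lemma nbhd_base_unit_interval: "neighbourhood_base_of (compactin unit_interval) unit_interval"
proof -
  have "compact_space unit_interval"
    by (simp add: compact_space_subtopology)
  moreover have "Hausdorff_space unit_interval"
    by (simp add: Hausdorff_space_subtopology)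
  ultimately show ?thesis
    using compact_imp_locally_compact_space locally_compact_space_neighbourhood_base by blast
qed

lemma topspace_paths:
  "topspace (compact_open_topology unit_interval X) =
     {\<gamma> \<in> extensional {0..1}. continuous_map unit_interval X \<gamma>}"
  by (simp add: topspace_compact_open)

lemma path_in_topspace:
  assumes "\<gamma> \<in> topspace (compact_open_topology unit_interval X)" "t \<in> {0..1}"
  shows "\<gamma> t \<in> topspace X"
  using assms continuous_map_image_subset_topspace[of unit_interval X \<gamma>]
  by (auto simp: topspace_paths)

lemma G_space_paths:
  assumes TG: "topological_group G T" and X: "G_space G T X a"
  shows "G_space G T (compact_open_topology unit_interval X) (path_action a)"
proof (rule G_spaceI)
  let ?P = "compact_open_topology unit_interval X"
  show "group G" and T: "topspace T = carrier G"
    using TG by (simp_all add: topological_group_def)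
  then interpret group G by simp
  show "Hausdorff_space ?P"
    using G_spaceD(1)[OF X] by (rule Hausdorff_compact_open)
  have "continuous_map (prod_topology (prod_topology T ?P) unit_interval) X
          (\<lambda>w. (\<lambda>(g, x). a g x) (fst (fst w), (\<lambda>(f, t). f t) (snd (fst w), snd w)))"
    using continuous_map_compose[OF continuous_map_pairedI[OF
        continuous_map_compose[OF continuous_map_fst continuous_map_fst]
        continuous_map_compose[OF continuous_map_pairedI[OF
          continuous_map_compose[OF continuous_map_fst continuous_map_snd] continuous_map_snd]
          continuous_map_eval[OF nbhd_base_unit_interval]]] G_spaceD(2)[OF X]]
    by (simp add: o_def)
  from continuous_map_curry[OF this]
  show "continuous_map (prod_topology T ?P) ?P (\<lambda>(g, x). path_action a g x)"
    by (simp add: path_action_def case_prod_unfold)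
  show "path_action a \<one>\<^bsub>G\<^esub> \<gamma> = \<gamma>" if "\<gamma> \<in> topspace ?P" for \<gamma>
    using that path_in_topspace[OF that] G_spaceD(4)[OF X]
    by (auto simp: path_action_def topspace_paths fun_eq_iff extensional_def)
  show "path_action a (g \<otimes>\<^bsub>G\<^esub> h) \<gamma> = path_action a g (path_action a h \<gamma>)"
    if "g \<in> carrier G" "h \<in> carrier G" "\<gamma> \<in> topspace ?P" for g h \<gamma>
    using that path_in_topspace[OF that(3)] G_spaceD(5)[OF X]
    by (auto simp: path_action_def fun_eq_iff)
qed

theorem G_fibration_lifting:
  fixes X :: "'x topology" and E :: "'e topology" and B :: "'b topology"
  assumes TG: "topological_group G T" and p: "G_fibration G T E a B b p"
    and X: "G_space G T X c"
  shows "G_homotopy_lifting G X c E a B b p"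
proof -
  let ?C = "compact_open_topology unit_interval B"
  define P where "P = subtopology (prod_topology E ?C) {(e, \<omega>). \<omega> 0 = p e}"
  define d where "d = (\<lambda>g (e, \<omega>). (a g e, path_action b g \<omega>))"
  have G: "group G" and T: "topspace T = carrier G"
    using TG by (simp_all add: topological_group_def)
  have E: "G_space G T E a" and B: "G_space G T B b"
    and pc: "continuous_map E B p" and pe: "equivariant G E a b p"
    using p by (simp_all add: G_fibration_def G_map_def)
  note C = G_space_paths[OF TG B]
  have Pt: "topspace P = {(e, \<omega>). e \<in> topspace E \<and> \<omega> \<in> topspace ?C \<and> \<omega> 0 = p e}"
    by (auto simp: P_def)
  have Pfst: "continuous_map P E fst" and Psnd: "continuous_map P ?C snd"
    unfolding P_def
    by (intro continuous_map_from_subtopology continuous_map_fst continuous_map_snd)+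
  have P: "G_space G T P d"
  proof (rule G_spaceI[OF G T])
    show "Hausdorff_space P"
      unfolding P_def using G_spaceD(1)[OF E] G_spaceD(1)[OF C]
      by (intro Hausdorff_space_subtopology) (simp add: Hausdorff_space_prod_topology)
    have "continuous_map (prod_topology T P) (prod_topology E ?C) (\<lambda>w.
        ((\<lambda>(g, x). a g x) (fst w, fst (snd w)), (\<lambda>(g, x). path_action b g x) (fst w, snd (snd w))))"
      using continuous_map_compose[OF continuous_map_pairedI[OF continuous_map_fst
              continuous_map_compose[OF continuous_map_snd Pfst]] G_spaceD(2)[OF E]]
            continuous_map_compose[OF continuous_map_pairedI[OF continuous_map_fst
              continuous_map_compose[OF continuous_map_snd Psnd]] G_spaceD(2)[OF C]]
      by (intro continuous_map_pairedI) (simp_all add: o_def)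
    moreover have "d g x \<in> {(e, \<omega>). \<omega> 0 = p e}" if "g \<in> topspace T" "x \<in> topspace P" for g x
      using that pe T by (auto simp: d_def Pt path_action_def equivariant_def)
    ultimately show "continuous_map (prod_topology T P) P (\<lambda>(g, x). d g x)"
      unfolding P_def continuous_map_in_subtopology
      by (auto simp: d_def case_prod_unfold P_def)
    show "d \<one>\<^bsub>G\<^esub> x = x" if "x \<in> topspace P" for x
      using that by (cases x) (simp add: Pt d_def G_spaceD(4)[OF E] G_spaceD(4)[OF C])
    show "d (g \<otimes>\<^bsub>G\<^esub> h) x = d g (d h x)"
      if "g \<in> carrier G" "h \<in> carrier G" "x \<in> topspace P" for g h x
      using that by (cases x) (simp add: Pt d_def G_spaceD(5)[OF E] G_spaceD(5)[OF C])
  qed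
  show ?thesis
    unfolding G_homotopy_lifting_def
  proof (intro allI impI, elim conjE)
    fix f H
    assume f: "G_map G X c E a f"
      and H: "G_map G (prod_topology unit_interval X) (cylinder_action c) B b H"
      and f0: "\<forall>x\<in>topspace X. H (0, x) = p (f x)"
    define u where "u x = (f x, \<lambda>t\<in>{0..1}. H (t, x))" for x
    define ev where "ev = (\<lambda>(t, e :: 'e, \<omega>). (\<omega> :: real \<Rightarrow> 'b) (t::real))"
    have "continuous_map (prod_topology X unit_interval) B (\<lambda>w. H (snd w, fst w))"
      using H continuous_map_compose[OF continuous_map_pairedI[OF continuous_map_snd
        continuous_map_fst], where g = H]
      by (simp add: G_map_def o_def)
    from continuous_map_curry[OF this]
    have "continuous_map X ?C (\<lambda>x. \<lambda>t\<in>{0..1}. H (t, x))" by simp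
    then have uc': "continuous_map X (prod_topology E ?C) u"
      unfolding u_def using f by (intro continuous_map_pairedI) (auto simp: G_map_def)
    then have uc: "continuous_map X P u"
      unfolding P_def continuous_map_in_subtopology using f0 by (auto simp: u_def)
    have ue: "equivariant G X c d u"
      using f H by (auto simp: equivariant_def G_map_def u_def d_def path_action_def
          cylinder_action_def fun_eq_iff)
    have "continuous_map (prod_topology unit_interval P) B (\<lambda>w. (\<lambda>(f, t). f t) (snd (snd w), fst w))"
      using continuous_map_compose[OF continuous_map_pairedI[OF
          continuous_map_compose[OF continuous_map_snd Psnd] continuous_map_fst]
          continuous_map_eval[OF nbhd_base_unit_interval]]
      by (simp add: o_def)
    then have "continuous_map (prod_topology unit_interval P) B ev"
      by (simp add: ev_def case_prod_unfold)
    then have ev: "G_map G (prod_topology unit_interval P) (cylinder_action d) B b ev"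
      by (auto simp: G_map_def equivariant_def ev_def cylinder_action_def d_def path_action_def)
    have fs: "G_map G P d E a fst"
      using Pfst by (auto simp: G_map_def equivariant_def d_def)
    have "G_homotopy_lifting G P d E a B b p"
      using p P by (simp add: G_fibration_def)
    moreover have "\<forall>x\<in>topspace P. ev (0, x) = p (fst x)"
      by (auto simp: Pt ev_def)
    ultimately obtain K where
      K: "G_map G (prod_topology unit_interval P) (cylinder_action d) E a K"
      and K0: "\<forall>x\<in>topspace P. K (0, x) = fst x"
      and Kp: "\<forall>t\<in>{0..1}. \<forall>x\<in>topspace P. p (K (t, x)) = ev (t, x)"
      using ev fs unfolding G_homotopy_lifting_def by blast
    have uP: "u x \<in> topspace P" if "x \<in> topspace X" for x
      using uc that continuous_map_image_subset_topspace by blast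
    define L where "L = (\<lambda>w. K (fst w, u (snd w)))"
    have "continuous_map (prod_topology unit_interval X) E L"
      using K continuous_map_compose[OF continuous_map_pairedI[OF continuous_map_fst
          continuous_map_compose[OF continuous_map_snd uc]], where g = K]
      by (simp add: G_map_def L_def o_def)
    moreover have "equivariant G (prod_topology unit_interval X) (cylinder_action c) a L"
      using K ue uP by (auto simp: G_map_def equivariant_def L_def cylinder_action_def)
    ultimately have "G_map G (prod_topology unit_interval X) (cylinder_action c) E a L"
      by (simp add: G_map_def)
    moreover have "\<forall>x\<in>topspace X. L (0, x) = f x"
      using K0 uP by (simp add: L_def u_def)
    moreover have "\<forall>t\<in>{0..1}. \<forall>x\<in>topspace X. p (L (t, x)) = H (t, x)"
      using Kp uP by (simp add: L_def ev_def u_def)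
    ultimately show "\<exists>K. G_map G (prod_topology unit_interval X) (cylinder_action c) E a K \<and>
           (\<forall>x\<in>topspace X. K (0, x) = f x) \<and>
           (\<forall>t\<in>{0..1}. \<forall>x\<in>topspace X. p (K (t, x)) = H (t, x))"
      by blast
  qed
qed

end

theory Submission
  imports Defs
begin

text \<open>
  Invariant parametrized topological complexity is monotone under fibrewise domination: if
  \<open>f : E \<rightarrow> E'\<close> and \<open>f' : E' \<rightarrow> E\<close> are fibrewise equivariant maps and \<open>f' \<circ> f\<close> is fibrewise
  equivariantly homotopic to the identity, then the complexity of \<open>E\<close> is at most that of \<open>E'\<close>.
  Applying this in both directions gives the theorem.

  The reason is that everything in the definition is functorial. The map \<open>f \<times> f\<close> pulls an
  invariant open cover of the orbit fibre product of \<open>E'\<close> back to one of the orbit fibre product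
  of \<open>E\<close>; a local section \<open>s\<close> over a member of the first cover becomes the section
  \<open>f'\<^sub>* \<circ> s \<circ> (f \<times> f)\<close>, where \<open>f'\<^sub>*\<close> composes paths with \<open>f'\<close>. Since the outer endpoint
  maps \<open>\<Psi>\<close> and \<open>\<Psi>'\<close> of the two projections commute with composing paths, \<open>\<Psi>\<close> takes the new section
  to \<open>(f' \<times> f') \<circ> \<Psi>' \<circ> s \<circ> (f \<times> f)\<close>. This is homotopic to
  \<open>(f' \<circ> f) \<times> (f' \<circ> f)\<close> because \<open>\<Psi>' \<circ> s\<close> is homotopic to the inclusion, and that in turn is
  homotopic to the identity by applying the homotopy \<open>f' \<circ> f \<simeq> id\<close> in both coordinates. The
  latter stays in the orbit fibre product exactly because the homotopy is fibrewise.

  The formal part of this argument, about the sectional category of arbitrary equivariant maps, is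
  \<open>secat_le_of_dominated\<close>; its hypotheses for the endpoint maps are established in the subsequent
  lemmas.
\<close>

lemma G_mapD:
  assumes "G_map K X a Y b f"
  shows "continuous_map X Y f"
    and "\<And>x. x \<in> topspace X \<Longrightarrow> f x \<in> topspace Y"
    and "\<And>g x. g \<in> carrier K \<Longrightarrow> x \<in> topspace X \<Longrightarrow> f (a g x) = b g (f x)"
  using assms continuous_map_image_subset_topspace[of X Y f]
  by (auto simp: G_map_def equivariant_def)

lemma G_map_compose:
  assumes "G_map K X a Y b f" "G_map K Y b Z c h"
  shows "G_map K X a Z c (h \<circ> f)"
  using continuous_map_compose[OF G_mapD(1)[OF assms(1)] G_mapD(1)[OF assms(2)]]
    G_mapD(2,3)[OF assms(1)] G_mapD(3)[OF assms(2)]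
  by (simp add: G_map_def equivariant_def)

lemma G_homotopic_compose_left:
  assumes hom: "G_homotopic K X a Y b f g" and h: "G_map K Y b Z c h"
  shows "G_homotopic K X a Z c (h \<circ> f) (h \<circ> g)"
proof -
  \<comment> \<open>Equivariance of \<open>h\<close> is only available on \<open>Y\<close>, so each stage must be known to map into \<open>Y\<close>.\<close>
  have "homotopic_with (\<lambda>j. G_map K X a Y b j) X Y f g"
    using hom unfolding G_homotopic_def by (rule homotopic_with_mono) (simp add: G_map_def)
  then show ?thesis
    unfolding G_homotopic_def
    by (rule homotopic_with_compose_continuous_map_left[OF _ G_mapD(1)[OF h]])
       (use G_map_compose[OF _ h] in \<open>auto simp: G_map_def\<close>)
qed

lemma G_homotopic_compose_right:
  assumes hom: "G_homotopic K Y b Z c f g" and h: "G_map K X a Y b h"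
  shows "G_homotopic K X a Z c (f \<circ> h) (g \<circ> h)"
  using hom unfolding G_homotopic_def
  by (rule homotopic_with_compose_continuous_map_right[OF _ G_mapD(1)[OF h]])
     (use G_mapD(2,3)[OF h] in \<open>auto simp: equivariant_def\<close>)

lemma equivariant_cong_on_space:
  assumes "\<And>g x. g \<in> carrier K \<Longrightarrow> x \<in> topspace X \<Longrightarrow> a g x \<in> topspace X"
    and "\<And>x. x \<in> topspace X \<Longrightarrow> f x = h x"
  shows "equivariant K X a b f \<longleftrightarrow> equivariant K X a b h"
  using assms by (auto simp: equivariant_def)


section \<open>Sectional category of a dominated map\<close>

text \<open>
  Pull a cover by domains of local sections back along \<open>\<phi>\<close> and transport the sections by \<open>\<kappa>\<close>.
  The square formed by \<open>\<kappa>\<close>, \<open>\<psi>\<close>, \<open>q'\<close> and \<open>q\<close> turns them into homotopy sections of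
  \<open>\<psi> \<circ> \<phi>\<close>, hence of the identity.
\<close>

lemma secat_le_of_dominated:
  fixes Y :: "'y topology"
  assumes act: "\<And>g y. g \<in> carrier K \<Longrightarrow> y \<in> topspace Y \<Longrightarrow> b g y \<in> topspace Y"
    and phi: "G_map K Y b Y' b' \<phi>" and psi: "G_map K Y' b' Y b \<psi>"
    and hom: "G_homotopic K Y b Y b (\<psi> \<circ> \<phi>) id"
    and kappa: "G_map K X' a' X a \<kappa>"
    and square: "\<And>x. x \<in> topspace X' \<Longrightarrow> q (\<kappa> x) = \<psi> (q' x)"
  shows "secat K X a Y b q \<le> secat K X' a' Y' b' q'"
  unfolding secat_def
proof (rule Inf_superset_mono, safe)
  fix k :: nat and U s
  assume k: "1 \<le> k" and cover: "(\<Union>i\<in>{1..k}. U i) = topspace Y'"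
    and U: "\<forall>i\<in>{1..k}. openin Y' (U i) \<and> (\<forall>g\<in>carrier K. b' g ` U i \<subseteq> U i) \<and>
          G_map K (subtopology Y' (U i)) b' X' a' (s i) \<and>
          G_homotopic K (subtopology Y' (U i)) b' Y' b' (q' \<circ> s i) id"
  define V where "V i = {y \<in> topspace Y. \<phi> y \<in> U i}" for i
  have "openin Y (V i) \<and> (\<forall>g\<in>carrier K. b g ` V i \<subseteq> V i) \<and>
      G_map K (subtopology Y (V i)) b X a (\<kappa> \<circ> s i \<circ> \<phi>) \<and>
      G_homotopic K (subtopology Y (V i)) b Y b (q \<circ> (\<kappa> \<circ> s i \<circ> \<phi>)) id"
    if i: "i \<in> {1..k}" for i
  proof (intro conjI)
    have op: "openin Y' (U i)" and inv: "\<And>g. g \<in> carrier K \<Longrightarrow> b' g ` U i \<subseteq> U i"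
      and s: "G_map K (subtopology Y' (U i)) b' X' a' (s i)"
      and sec: "G_homotopic K (subtopology Y' (U i)) b' Y' b' (q' \<circ> s i) id"
      using U i by auto
    show "openin Y (V i)"
      unfolding V_def using G_mapD(1)[OF phi] op by (rule openin_continuous_map_preimage)
    show invV: "\<forall>g\<in>carrier K. b g ` V i \<subseteq> V i"
      using act inv G_mapD(3)[OF phi] by (fastforce simp: V_def)
    have phiV: "G_map K (subtopology Y (V i)) b (subtopology Y' (U i)) b' \<phi>"
      using phi by (auto simp: G_map_def equivariant_def V_def continuous_map_in_subtopology
          continuous_map_from_subtopology)
    show "G_map K (subtopology Y (V i)) b X a (\<kappa> \<circ> s i \<circ> \<phi>)"
      using G_map_compose[OF phiV G_map_compose[OF s kappa]] by (simp add: o_assoc)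
    have "G_homotopic K (subtopology Y (V i)) b Y b (\<psi> \<circ> ((q' \<circ> s i) \<circ> \<phi>)) (\<psi> \<circ> (id \<circ> \<phi>))"
      using G_homotopic_compose_left[OF G_homotopic_compose_right[OF sec phiV] psi] .
    moreover have "G_homotopic K (subtopology Y (V i)) b Y b (\<psi> \<circ> \<phi>) id"
      using G_homotopic_compose_right[OF hom, of "subtopology Y (V i)" b id]
      by (simp add: G_map_def equivariant_def)
    ultimately have "G_homotopic K (subtopology Y (V i)) b Y b (\<psi> \<circ> ((q' \<circ> s i) \<circ> \<phi>)) id"
      unfolding G_homotopic_def id_comp by (rule homotopic_with_trans)
    then show "G_homotopic K (subtopology Y (V i)) b Y b (q \<circ> (\<kappa> \<circ> s i \<circ> \<phi>)) id"
      unfolding G_homotopic_def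
    proof (rule homotopic_with_eq)
      fix y assume "y \<in> topspace (subtopology Y (V i))"
      then show "(q \<circ> (\<kappa> \<circ> s i \<circ> \<phi>)) y = (\<psi> \<circ> ((q' \<circ> s i) \<circ> \<phi>)) y"
        using square G_mapD(2)[OF s] G_mapD(2)[OF phiV] by simp
    next
      fix h j :: "'y \<Rightarrow> 'y"
      assume "\<And>y. y \<in> topspace (subtopology Y (V i)) \<Longrightarrow> h y = j y"
      then show "equivariant K (subtopology Y (V i)) b b h \<longleftrightarrow>
          equivariant K (subtopology Y (V i)) b b j"
        using act invV by (intro equivariant_cong_on_space) (auto simp: image_subset_iff)
    qed simp
  qed
  moreover have "(\<Union>i\<in>{1..k}. V i) = topspace Y"
    using cover G_mapD(2)[OF phi] by (auto simp: V_def)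
  ultimately show "\<exists>k'. enat k = enat k' \<and> k' \<ge> 1 \<and>
    (\<exists>U s. (\<Union>i\<in>{1..k'}. U i) = topspace Y \<and>
       (\<forall>i\<in>{1..k'}.
          openin Y (U i) \<and> (\<forall>g\<in>carrier K. b g ` U i \<subseteq> U i) \<and>
          G_map K (subtopology Y (U i)) b X a (s i) \<and>
          G_homotopic K (subtopology Y (U i)) b Y b (q \<circ> s i) id))"
    using k
    by (intro exI[of _ k] conjI refl exI[of _ V] exI[of _ "\<lambda>i. \<kappa> \<circ> s i \<circ> \<phi>"] ballI)
       (assumption | blast)+
qed


section \<open>Orbits\<close>

lemma orbit_act_eq:
  assumes G: "group G" and X: "G_space G T X a" and g: "g \<in> carrier G" and x: "x \<in> topspace X"
  shows "orbit G a (a g x) = orbit G a x"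
proof -
  interpret group G by (rule G)
  have 1: "a k (a g x) = a (k \<otimes>\<^bsub>G\<^esub> g) x" if "k \<in> carrier G" for k
    using G_spaceD(5)[OF X that g x] by (rule sym)
  show ?thesis
  proof
    show "orbit G a (a g x) \<subseteq> orbit G a x"
    proof
      fix z assume "z \<in> orbit G a (a g x)"
      then obtain k where k: "k \<in> carrier G" "z = a k (a g x)"
        by (auto simp: orbit_def)
      then have "k \<otimes>\<^bsub>G\<^esub> g \<in> carrier G" "z = a (k \<otimes>\<^bsub>G\<^esub> g) x"
        using 1[OF k(1)] g by simp_all
      then show "z \<in> orbit G a x"
        unfolding orbit_def by blast
    qed
    show "orbit G a x \<subseteq> orbit G a (a g x)"
    proof
      fix z assume "z \<in> orbit G a x"
      then obtain k where k: "k \<in> carrier G" "z = a k x"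
        by (auto simp: orbit_def)
      let ?k = "k \<otimes>\<^bsub>G\<^esub> inv\<^bsub>G\<^esub> g"
      have "?k \<in> carrier G" "?k \<otimes>\<^bsub>G\<^esub> g = k"
        using k(1) g by (simp_all add: m_assoc)
      then have "?k \<in> carrier G" "z = a ?k (a g x)"
        using 1[of ?k] k(2) by simp_all
      then show "z \<in> orbit G a (a g x)"
        unfolding orbit_def by blast
    qed
  qed
qed

lemma orbit_equivariant_image:
  assumes "G_map G X a Y b f" "x \<in> topspace X"
  shows "orbit G b (f x) = f ` orbit G a x"
  using G_mapD(3)[OF assms(1) _ assms(2)] by (force simp: orbit_def)


section \<open>Functoriality of orbit fibre products and of path pairs\<close>

lemma topspace_orbit_fibre_product:
  "topspace (orbit_fibre_product G E b p) =
    {(x, y). x \<in> topspace E \<and> y \<in> topspace E \<and> orbit G b (p x) = orbit G b (p y)}"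
  by (auto simp: orbit_fibre_product_def)

lemma prod_action_orbit_fibre_product:
  assumes G: "group G" and E: "G_space G T E a" and B: "G_space G T B b"
    and p: "G_map G E a B b p"
    and g: "g \<in> carrier (G \<times>\<times> G)" and y: "y \<in> topspace (orbit_fibre_product G E b p)"
  shows "prod_action a g y \<in> topspace (orbit_fibre_product G E b p)"
  using g y G_spaceD(3)[OF E] G_mapD(2,3)[OF p] orbit_act_eq[OF G B]
  by (auto simp: topspace_orbit_fibre_product prod_action_def)

lemma G_map_orbit_fibre_product:
  assumes f: "G_map G E a E' a' f" and over: "\<And>x. x \<in> topspace E \<Longrightarrow> p' (f x) = p x"
  shows "G_map (G \<times>\<times> G) (orbit_fibre_product G E b p) (prod_action a)
    (orbit_fibre_product G E' b p') (prod_action a') (map_prod f f)"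
proof -
  have "continuous_map (prod_topology E E) (prod_topology E' E') (\<lambda>w. (f (fst w), f (snd w)))"
    using G_mapD(1)[OF f]
    by (intro continuous_map_pairedI continuous_map_compose[OF continuous_map_fst, unfolded o_def]
        continuous_map_compose[OF continuous_map_snd, unfolded o_def])
  then have "continuous_map (orbit_fibre_product G E b p) (prod_topology E' E') (map_prod f f)"
    unfolding orbit_fibre_product_def
    by (intro continuous_map_from_subtopology) (simp add: map_prod_def case_prod_unfold)
  then have "continuous_map (orbit_fibre_product G E b p) (orbit_fibre_product G E' b p')
      (map_prod f f)"
    unfolding orbit_fibre_product_def[of G E'] continuous_map_in_subtopology
    using over by (auto simp: topspace_orbit_fibre_product)
  then show ?thesis
    using G_mapD(3)[OF f]
    by (auto simp: G_map_def equivariant_def topspace_orbit_fibre_product prod_action_def)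
qed

text \<open>
  The homotopy is run in both coordinates at once; each of its stages covers the identity of the
  base, so the orbit condition is preserved.
\<close>

lemma G_homotopic_orbit_fibre_product:
  assumes hom: "homotopic_with (\<lambda>h. equivariant G E a a h \<and> (\<forall>x\<in>topspace E. p (h x) = p x))
      E E f id"
  shows "G_homotopic (G \<times>\<times> G) (orbit_fibre_product G E b p) (prod_action a)
    (orbit_fibre_product G E b p) (prod_action a) (map_prod f f) id"
proof -
  let ?Y = "orbit_fibre_product G E b p"
  obtain h where h: "continuous_map (prod_topology unit_interval E) E h"
    and h0: "\<And>x. h (0, x) = f x" and h1: "\<And>x. h (1, x) = x"
    and eq: "\<And>t. t \<in> {0..1} \<Longrightarrow> equivariant G E a a (\<lambda>x. h (t, x))"
    and over: "\<And>t x. t \<in> {0..1} \<Longrightarrow> x \<in> topspace E \<Longrightarrow> p (h (t, x)) = p x"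
    using hom unfolding homotopic_with_def by auto
  define H where "H = (\<lambda>(t, x, y). (h (t, x), h (t, y)))"
  have sub: "continuous_map ?Y E fst" "continuous_map ?Y E snd"
    unfolding orbit_fibre_product_def
    by (intro continuous_map_from_subtopology continuous_map_fst continuous_map_snd)+
  have coord: "continuous_map (prod_topology unit_interval ?Y) E (\<lambda>w. h (fst w, r (snd w)))"
    if "continuous_map ?Y E r" for r
    using continuous_map_compose[OF continuous_map_pairedI[OF continuous_map_fst
        continuous_map_compose[OF continuous_map_snd that]] h]
    by (simp add: o_def)
  have "continuous_map (prod_topology unit_interval ?Y) (prod_topology E E) H"
    using continuous_map_pairedI[OF coord[OF sub(1)] coord[OF sub(2)]]
    by (simp add: H_def case_prod_unfold)
  then have "continuous_map (prod_topology unit_interval ?Y) ?Y H"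
    using over unfolding orbit_fibre_product_def[of G E] continuous_map_in_subtopology
    by (auto simp: H_def)
  moreover have "equivariant (G \<times>\<times> G) ?Y (prod_action a) (prod_action a) (\<lambda>y. H (t, y))"
    if "t \<in> {0..1}" for t
    using eq[OF that]
    by (auto simp: equivariant_def H_def prod_action_def topspace_orbit_fibre_product)
  ultimately show ?thesis
    unfolding G_homotopic_def homotopic_with_def
    by (intro exI[of _ H]) (auto simp: H_def h0 h1)
qed

definition map_path :: "('e \<Rightarrow> 'f) \<Rightarrow> (real \<Rightarrow> 'e) \<Rightarrow> real \<Rightarrow> 'f"
  where "map_path f \<gamma> = (\<lambda>t\<in>{0..1}. f (\<gamma> t))"

lemma continuous_map_map_path:
  assumes f: "continuous_map E E' f"
  shows "continuous_map (compact_open_topology unit_interval E)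
    (compact_open_topology unit_interval E') (map_path f)"
proof -
  have "continuous_map (prod_topology (compact_open_topology unit_interval E) unit_interval) E'
      (\<lambda>(\<gamma>, t). f (\<gamma> t))"
    using continuous_map_compose[OF continuous_map_eval[OF nbhd_base_unit_interval] f]
    by (simp add: o_def case_prod_unfold)
  from continuous_map_curry[OF this] show ?thesis
    by (simp add: map_path_def[abs_def])
qed

lemma topspace_fibre_paths:
  "topspace (fibre_paths E B p) = {\<gamma> \<in> topspace (compact_open_topology unit_interval E).
    \<exists>z\<in>topspace B. \<forall>t\<in>{0..1}. p (\<gamma> t) = z}"
  by (auto simp: fibre_paths_def)

lemma fibre_path_in_topspace:
  assumes "\<gamma> \<in> topspace (fibre_paths E B p)" "t \<in> {0..1}"
  shows "\<gamma> t \<in> topspace E"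
  using assms path_in_topspace by (auto simp: topspace_fibre_paths)

lemma continuous_map_fibre_paths:
  assumes f: "continuous_map E E' f" and over: "\<And>x. x \<in> topspace E \<Longrightarrow> p' (f x) = p x"
  shows "continuous_map (fibre_paths E B p) (fibre_paths E' B p') (map_path f)"
  unfolding fibre_paths_def[of E'] continuous_map_in_subtopology
proof
  show "continuous_map (fibre_paths E B p) (compact_open_topology unit_interval E') (map_path f)"
    unfolding fibre_paths_def
    using continuous_map_map_path[OF f] by (rule continuous_map_from_subtopology)
  have "p' (map_path f \<gamma> t) = p (\<gamma> t)" if "\<gamma> \<in> topspace (fibre_paths E B p)" "t \<in> {0..1}" for \<gamma> t
    using that over fibre_path_in_topspace[OF that] by (simp add: map_path_def)
  then show "map_path f \<in> topspace (fibre_paths E B p) \<rightarrow>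
      {\<gamma>. \<exists>z\<in>topspace B. \<forall>t\<in>{0..1}. p' (\<gamma> t) = z}"
    by (auto simp: topspace_fibre_paths)
qed

lemma topspace_fibre_path_pairs:
  "topspace (fibre_path_pairs G E a B p) =
    {(\<gamma>, \<delta>). \<gamma> \<in> topspace (fibre_paths E B p) \<and> \<delta> \<in> topspace (fibre_paths E B p) \<and>
      orbit G a (\<gamma> 1) = orbit G a (\<delta> 0)}"
  by (auto simp: fibre_path_pairs_def)

text \<open>
  An equivariant map sends orbits to orbits, so the pairs of paths that match at the junction up to
  the action are mapped to such pairs.
\<close>

lemma G_map_fibre_path_pairs:
  assumes f: "G_map G E a E' a' f" and over: "\<And>x. x \<in> topspace E \<Longrightarrow> p' (f x) = p x"
  shows "G_map (G \<times>\<times> G) (fibre_path_pairs G E a B p) (prod_action (path_action a))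
    (fibre_path_pairs G E' a' B p') (prod_action (path_action a'))
    (map_prod (map_path f) (map_path f))"
proof -
  let ?P = "fibre_paths E B p" and ?P' = "fibre_paths E' B p'"
  let ?F = "map_prod (map_path f) (map_path f)"
  have c: "continuous_map ?P ?P' (map_path f)"
    using G_mapD(1)[OF f] over by (rule continuous_map_fibre_paths)
  have "continuous_map (prod_topology ?P ?P) (prod_topology ?P' ?P')
      (\<lambda>w. (map_path f (fst w), map_path f (snd w)))"
    using c
    by (intro continuous_map_pairedI continuous_map_compose[OF continuous_map_fst, unfolded o_def]
        continuous_map_compose[OF continuous_map_snd, unfolded o_def])
  then have "continuous_map (fibre_path_pairs G E a B p) (prod_topology ?P' ?P') ?F"
    unfolding fibre_path_pairs_def
    by (intro continuous_map_from_subtopology) (simp add: map_prod_def case_prod_unfold)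
  moreover have "orbit G a' (map_path f \<gamma> 1) = orbit G a' (map_path f \<delta> 0)"
    if "(\<gamma>, \<delta>) \<in> topspace (fibre_path_pairs G E a B p)" for \<gamma> \<delta>
  proof -
    have "\<gamma> 1 \<in> topspace E" "\<delta> 0 \<in> topspace E" "orbit G a (\<gamma> 1) = orbit G a (\<delta> 0)"
      using that fibre_path_in_topspace[of _ E B p] by (auto simp: topspace_fibre_path_pairs)
    then show ?thesis
      using orbit_equivariant_image[OF f] by (simp add: map_path_def)
  qed
  ultimately have "continuous_map (fibre_path_pairs G E a B p) (fibre_path_pairs G E' a' B p') ?F"
    unfolding fibre_path_pairs_def[of G E'] continuous_map_in_subtopology by auto
  moreover have "map_path f (path_action a g \<gamma>) = path_action a' g (map_path f \<gamma>)"
    if "g \<in> carrier G" "\<gamma> \<in> topspace ?P" for g \<gamma>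
    using that G_mapD(3)[OF f] fibre_path_in_topspace[OF that(2)]
    by (auto simp: map_path_def path_action_def)
  ultimately show ?thesis
    by (auto simp: G_map_def equivariant_def topspace_fibre_path_pairs prod_action_def)
qed


section \<open>Monotonicity under fibrewise domination\<close>

lemma invariant_param_TC_le_of_dominated:
  assumes G: "group G" and E: "G_space G T E a" and B: "G_space G T B b"
    and p: "G_map G E a B b p"
    and f: "G_map G E a E' a' f" and f': "G_map G E' a' E a f'"
    and over: "\<And>x. x \<in> topspace E \<Longrightarrow> p' (f x) = p x"
    and over': "\<And>y. y \<in> topspace E' \<Longrightarrow> p (f' y) = p' y"
    and hom: "homotopic_with (\<lambda>h. equivariant G E a a h \<and> (\<forall>x\<in>topspace E. p (h x) = p x))
      E E (f' \<circ> f) id"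
  shows "invariant_param_TC G E a B b p \<le> invariant_param_TC G E' a' B b p'"
  unfolding invariant_param_TC_def
proof (rule secat_le_of_dominated)
  show "G_map (G \<times>\<times> G) (orbit_fibre_product G E b p) (prod_action a)
      (orbit_fibre_product G E' b p') (prod_action a') (map_prod f f)"
    using f over by (rule G_map_orbit_fibre_product)
  show "G_map (G \<times>\<times> G) (orbit_fibre_product G E' b p') (prod_action a')
      (orbit_fibre_product G E b p) (prod_action a) (map_prod f' f')"
    using f' over' by (rule G_map_orbit_fibre_product)
  show "G_homotopic (G \<times>\<times> G) (orbit_fibre_product G E b p) (prod_action a)
      (orbit_fibre_product G E b p) (prod_action a) (map_prod f' f' \<circ> map_prod f f) id"
    unfolding map_prod.comp by (rule G_homotopic_orbit_fibre_product[OF hom])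
  show "G_map (G \<times>\<times> G) (fibre_path_pairs G E' a' B p') (prod_action (path_action a'))
      (fibre_path_pairs G E a B p) (prod_action (path_action a))
      (map_prod (map_path f') (map_path f'))"
    using f' over' by (rule G_map_fibre_path_pairs)
  show "outer_endpoints (map_prod (map_path f') (map_path f') w) =
      map_prod f' f' (outer_endpoints w)" for w
    by (cases w) (simp add: outer_endpoints_def map_path_def)
qed (rule prod_action_orbit_fibre_product[OF G E B p])

theorem theorem4p3:
  fixes G :: "('g, 'm) monoid_scheme" and T :: "'g topology"
    and E :: "'e topology" and a :: "'g \<Rightarrow> 'e \<Rightarrow> 'e"
    and E' :: "'f topology" and a' :: "'g \<Rightarrow> 'f \<Rightarrow> 'f"
    and B :: "'b topology" and b :: "'g \<Rightarrow> 'b \<Rightarrow> 'b"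
    and p :: "'e \<Rightarrow> 'b" and p' :: "'f \<Rightarrow> 'b"
  assumes "topological_group G T"
    and "G_fibration G T E a B b p"
    and "G_fibration G T E' a' B b p'"
    and "fibrewise_G_homotopy_equivalent G E a p E' a' p'"
  shows "invariant_param_TC G E a B b p = invariant_param_TC G E' a' B b p'"
proof -
  have G: "group G"
    using assms(1) by (simp add: topological_group_def)
  have E: "G_space G T E a" and B: "G_space G T B b" and p: "G_map G E a B b p"
    using assms(2) by (simp_all add: G_fibration_def)
  have E': "G_space G T E' a'" and p': "G_map G E' a' B b p'"
    using assms(3) by (simp_all add: G_fibration_def)
  obtain f f' where f: "G_map G E a E' a' f" and f': "G_map G E' a' E a f'"
    and over: "\<And>x. x \<in> topspace E \<Longrightarrow> p' (f x) = p x"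
    and over': "\<And>y. y \<in> topspace E' \<Longrightarrow> p (f' y) = p' y"
    and hom: "homotopic_with (\<lambda>h. equivariant G E a a h \<and> (\<forall>x\<in>topspace E. p (h x) = p x))
        E E (f' \<circ> f) id"
    and hom': "homotopic_with (\<lambda>h. equivariant G E' a' a' h \<and> (\<forall>y\<in>topspace E'. p' (h y) = p' y))
        E' E' (f \<circ> f') id"
    using assms(4) unfolding fibrewise_G_homotopy_equivalent_def by blast
  show ?thesis
    using invariant_param_TC_le_of_dominated[OF G E B p f f' over over' hom]
      invariant_param_TC_le_of_dominated[OF G E' B p' f' f over' over hom']
    by (rule antisym)
qed

end
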